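(* Let $a\ge 1$ be an integer and consider the heteroclinic chain in vacuum Bianchi IX with constant continued fraction development $u=[a,a,a,\dots]$; its base points have Kasner parameters $u_m=[m,a,a,a,\dots]$, $m=1,\dots,a$. Then Takens-Linearization fails at some base point, i.e. there is $m\in\{1,\dots,a\}$ such that the Sternberg Non-Resonance Conditions (SNC) of order $\alpha(1)$ are violated at the base point with Kasner parameter $u_m$.
   Context: Continued fractions: $[a_0,a_1,a_2,\dots]=a_0+\cfrac{1}{a_1+\cfrac{1}{a_2+\cdots}}$ with positive integers $a_i$. Base points: a heteroclinic chain in Bianchi IX is described by its base points (equilibria on the Kasner circle), encoded by Kasner parameters $u\in(1,\infty)$. The next base point is given by the Kasner map $u\mapsto u-1$ if $u\ge 2$, $u\mapsto \frac1{u-1}$ if $1<u\le2$. Hence the chain started at $[a,a,a,\dots]$ has exactly the base points $[m,a,a,\dots]$, $m=1,\dots,a$. Eigenvalues: the linearized vector field at the base point with Kasner parameter $u$ has the three hyperbolic (nonzero) eigenvalues $$\lambda_1=\frac{-6u}{1+u+u^2},\quad \lambda_2=\frac{6(1+u)}{1+u+u^2},\quad \lambda_3=\frac{6u(1+u)}{1+u+u^2}.$$ Resonance Sign Condition (RSC): a triple $k=(k_1,k_2,k_3)\in\mathbb Z^3$ satisfies the RSC if either all $k_i$ have the same sign, or the one of the $k_i$ whose sign differs from that of the other two equals $\pm1$. SNC: put $$\beta(1)=\Big\lceil \tfrac{N+(M+n)}{n}\Big\rceil,\qquad \alpha(1)=\Big\lceil \tfrac{M+\beta(1)\,(N+m')}{m'}\Big\rceil,$$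 where $M=m'=|\lambda_1|$, $n=|\lambda_2|$, $N=|\lambda_3|$ (the argument $1$ refers to $C^1$ smoothness of the linearizing coordinates). The SNC (of order $\alpha(1)$) hold at the base point with parameter $u$ if there is no $k\in\mathbb Z^3\setminus\{0\}$ with $k_1\lambda_1+k_2\lambda_2+k_3\lambda_3=0$, satisfying the RSC, with $|k|:=|k_1|+|k_2|+|k_3|\le\alpha(1)$. One says that Takens-Linearization is possible at the base point if the SNC hold there, and that it fails if the SNC are violated. *)

theory Defs
  imports Complex_Main
begin

fun cf_convergent :: "(nat \<Rightarrow> nat) \<Rightarrow> nat \<Rightarrow> real" where
  "cf_convergent c 0 = real (c 0)"
| "cf_convergent c (Suc n) = real (c 0) + 1 / cf_convergent (\<lambda>i. c (Suc i)) n"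

text \<open>The value of the infinite continued fraction \<open>[c 0, c 1, c 2, \<dots>]\<close>, meaningful for
  positive entries, for which the convergents converge.\<close>

definition cf_value :: "(nat \<Rightarrow> nat) \<Rightarrow> real" where
  "cf_value c = lim (cf_convergent c)"

definition kasner_map :: "real \<Rightarrow> real" where
  "kasner_map u = (if u \<ge> 2 then u - 1 else 1 / (u - 1))"

text \<open>Base points are represented by their Kasner parameters.\<close>

definition base_points :: "real \<Rightarrow> real set" where
  "base_points u = {(kasner_map ^^ j) u | j. True}"

text \<open>The three hyperbolic eigenvalues of the linearized Bianchi IX vector field at the
  equilibrium on the Kasner circle with parameter \<open>u\<close>.\<close>

definition eigval1 :: "real \<Rightarrow> real" where
  "eigval1 u = - 6 * u / (1 + u + u\<^sup>2)"

definition eigval2 :: "real \<Rightarrow> real" where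
  "eigval2 u = 6 * (1 + u) / (1 + u + u\<^sup>2)"

definition eigval3 :: "real \<Rightarrow> real" where
  "eigval3 u = 6 * u * (1 + u) / (1 + u + u\<^sup>2)"

text \<open>Resonance Sign Condition. Here 0 counts as a sign of its own. Letting 0 count as either
  sign would only admit more triples, so a violation of the non-resonance conditions below is
  also a violation under that convention.\<close>

definition RSC :: "int \<Rightarrow> int \<Rightarrow> int \<Rightarrow> bool" where
  "RSC k1 k2 k3 \<longleftrightarrow>
     (sgn k1 = sgn k2 \<and> sgn k2 = sgn k3) \<or>
     (sgn k2 = sgn k3 \<and> sgn k1 \<noteq> sgn k2 \<and> k1 \<in> {1, -1}) \<or>
     (sgn k1 = sgn k3 \<and> sgn k2 \<noteq> sgn k1 \<and> k2 \<in> {1, -1}) \<or>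
     (sgn k1 = sgn k2 \<and> sgn k3 \<noteq> sgn k1 \<and> k3 \<in> {1, -1})"

text \<open>With \<open>m\<close>, \<open>M\<close> the smallest and largest modulus of the contracting eigenvalues and
  \<open>n\<close>, \<open>N\<close> those of the expanding ones; there is a single contracting eigenvalue, so
  \<open>m = M\<close>. The suffix 1 refers to \<open>C\<^sup>1\<close> smoothness of the linearizing coordinates.\<close>

definition beta1 :: "real \<Rightarrow> int" where
  "beta1 u = (let M = \<bar>eigval1 u\<bar>; n = \<bar>eigval2 u\<bar>; N = \<bar>eigval3 u\<bar>
              in \<lceil>(N + (M + n)) / n\<rceil>)"

definition alpha1 :: "real \<Rightarrow> int" where
  "alpha1 u = (let M = \<bar>eigval1 u\<bar>; m = \<bar>eigval1 u\<bar>; N = \<bar>eigval3 u\<bar>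
               in \<lceil>(M + of_int (beta1 u) * (N + m)) / m\<rceil>)"

definition SNC :: "int \<Rightarrow> real \<Rightarrow> bool" where
  "SNC r u \<longleftrightarrow>
     \<not> (\<exists>k1 k2 k3 :: int.
          (k1, k2, k3) \<noteq> (0, 0, 0) \<and>
          of_int k1 * eigval1 u + of_int k2 * eigval2 u + of_int k3 * eigval3 u = 0 \<and>
          RSC k1 k2 k3 \<and>
          \<bar>k1\<bar> + \<bar>k2\<bar> + \<bar>k3\<bar> \<le> r)"

definition takens_linearization_possible :: "real \<Rightarrow> bool" where
  "takens_linearization_possible u \<longleftrightarrow> SNC (alpha1 u) u"

end

theory Submission
  imports Defs
begin

text \<open>The base point with \<open>m = a\<close> always fails: its parameter \<open>x = [a, a, \<dots>]\<close> satisfies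
  \<open>x\<^sup>2 = a x + 1\<close>, which says precisely that \<open>k = (a, -1, 1)\<close> is a resonance. This \<open>k\<close> satisfies
  the RSC and has \<open>\<bar>k\<bar> = a + 2\<close>, whereas already \<open>\<alpha>(1) \<ge> 1 + \<beta>(1) (x + 2) > a + 2\<close>.\<close>

definition metallic_mean :: "nat \<Rightarrow> real" where
  "metallic_mean a = (real a + sqrt ((real a)\<^sup>2 + 4)) / 2"

lemma metallic_mean_square: "(metallic_mean a)\<^sup>2 = real a * metallic_mean a + 1"
proof -
  have "(sqrt ((real a)\<^sup>2 + 4))\<^sup>2 = (real a)\<^sup>2 + 4"
    by simp
  then show ?thesis
    unfolding metallic_mean_def by (simp add: power2_eq_square field_simps)
qed

lemma metallic_mean_pos: "metallic_mean a > 0"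
  unfolding metallic_mean_def by (simp add: add_nonneg_pos add_pos_nonneg)

lemma metallic_mean_fixpoint: "metallic_mean a = real a + 1 / metallic_mean a"
  using metallic_mean_square[of a] metallic_mean_pos[of a]
  by (simp add: field_simps power2_eq_square)

lemma metallic_mean_greater: "real a < metallic_mean a"
  using metallic_mean_fixpoint[of a] metallic_mean_pos[of a]
  by (metis less_add_same_cancel1 zero_less_divide_1_iff)

text \<open>For \<open>a \<ge> 1\<close> this keeps every convergent at least 1, so the denominators
  in the contraction estimate stay away from 0.\<close>

lemma cf_convergent_const_ge: "cf_convergent (\<lambda>_. a) n \<ge> real a"
  by (induction n) auto

text \<open>The map \<open>t \<mapsto> a + 1/t\<close> fixes \<open>metallic_mean a\<close>, and for
  \<open>t \<ge> 1\<close> one application shrinks the distance to this fixed point by a factor of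
  at most \<open>1 / metallic_mean a\<close>.\<close>

lemma cf_convergent_const_dist:
  assumes "a \<ge> 1"
  shows "\<bar>cf_convergent (\<lambda>_. a) n - metallic_mean a\<bar>
    \<le> \<bar>real a - metallic_mean a\<bar> * (1 / metallic_mean a) ^ n"
proof (induction n)
  case 0
  then show ?case by simp
next
  case (Suc n)
  let ?c = "cf_convergent (\<lambda>_. a) n" and ?x = "metallic_mean a"
  have c: "?c \<ge> 1"
    using cf_convergent_const_ge[of a n] assms by linarith
  have x: "?x > 0"
    by (rule metallic_mean_pos)
  \<comment> \<open>Unfolding \<open>?x\<close> on the left once makes the leading \<open>a\<close>
    cancel. A single \<open>subst\<close> is used because the fixpoint equation loops as a simp
    rule.\<close>
  have "cf_convergent (\<lambda>_. a) (Suc n) - ?x = 1 / ?c - 1 / ?x"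
    by (subst metallic_mean_fixpoint) simp
  also have "\<dots> = (?x - ?c) / (?c * ?x)"
    using c x by (simp add: field_simps)
  finally have "\<bar>cf_convergent (\<lambda>_. a) (Suc n) - ?x\<bar> = \<bar>?c - ?x\<bar> / (?c * ?x)"
    using c x by (simp add: abs_minus_commute)
  also have "\<dots> \<le> \<bar>?c - ?x\<bar> / ?x"
    using c x by (intro divide_left_mono) auto
  also have "\<dots> \<le> (\<bar>real a - ?x\<bar> * (1 / ?x) ^ n) / ?x"
    using Suc.IH x by (intro divide_right_mono) auto
  finally show ?case by simp
qed

lemma cf_convergent_const_tendsto:
  assumes "a \<ge> 1"
  shows "cf_convergent (\<lambda>_. a) \<longlonglongrightarrow> metallic_mean a"
proof -
  let ?x = "metallic_mean a"
  \<comment> \<open>This makes the contraction ratio strictly less than 1, so the error bound is a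
    null sequence that dominates the error.\<close>
  have "?x > 1"
    using metallic_mean_greater[of a] assms by linarith
  then have "(\<lambda>n. \<bar>real a - ?x\<bar> * (1 / ?x) ^ n) \<longlonglongrightarrow> 0"
    by (intro tendsto_mult_right_zero LIMSEQ_power_zero) auto
  then have "(\<lambda>n. cf_convergent (\<lambda>_. a) n - ?x) \<longlonglongrightarrow> 0"
    by (rule tendsto_0_le[where K = 1])
      (use cf_convergent_const_dist[OF assms] metallic_mean_pos[of a]
        in \<open>auto simp: abs_mult power_abs intro!: always_eventually\<close>)
  then show ?thesis
    by (simp add: LIM_zero_iff)
qed

text \<open>From index 1 on, the convergents are \<open>m + 1/c\<close> with \<open>c\<close> a
  convergent of the constant tail, so the limit passes through.\<close>

lemma cf_value_Cons_const:
  assumes "a \<ge> 1"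
  shows "cf_value (\<lambda>i. if i = 0 then m else a) = real m + 1 / metallic_mean a"
proof -
  have "(\<lambda>n. cf_convergent (\<lambda>i. if i = 0 then m else a) (Suc n))
      \<longlonglongrightarrow> real m + 1 / metallic_mean a"
    using metallic_mean_pos[of a]
    by (auto intro!: tendsto_intros cf_convergent_const_tendsto[OF assms])
  then show ?thesis
    unfolding cf_value_def by (intro limI) (simp only: filterlim_sequentially_Suc)
qed

lemma cf_value_const:
  assumes "a \<ge> 1"
  shows "cf_value (\<lambda>_. a) = metallic_mean a"
  using cf_convergent_const_tendsto[OF assms] unfolding cf_value_def by (rule limI)

text \<open>The common denominator of the eigenvalues cancels, and the crude bound
  \<open>beta1 u \<ge> 1\<close>, valid for the ceiling of a positive number, is enough.\<close>

lemma alpha1_ge: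
  assumes "u > 0"
  shows "u + 2 \<le> of_int (alpha1 u)"
proof -
  define D where "D = 1 + u + u\<^sup>2"
  have D: "D > 0"
    using assms by (simp add: D_def add_pos_pos)
  have e: "\<bar>eigval1 u\<bar> = 6 * u / D" "\<bar>eigval2 u\<bar> = 6 * (1 + u) / D"
    "\<bar>eigval3 u\<bar> = 6 * u * (1 + u) / D"
    using assms D by (simp_all add: eigval1_def eigval2_def eigval3_def flip: D_def)
  have "(6 * u * (1 + u) / D + (6 * u / D + 6 * (1 + u) / D)) / (6 * (1 + u) / D) > 0"
    using assms D by (intro divide_pos_pos add_pos_pos) auto
  then have beta: "beta1 u \<ge> 1"
    unfolding beta1_def Let_def e by linarith
  have "1 * (u + 2) \<le> of_int (beta1 u) * (u + 2)"
    using beta assms by (intro mult_right_mono) auto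
  then have "u + 2 \<le> 1 + of_int (beta1 u) * (u + 2)"
    unfolding mult_1_left by (rule order_trans) simp
  \<comment> \<open>Here M/m' = 1 and N/m' = 1 + u, whence (N + m')/m' = u + 2.\<close>
  also have "\<dots> = (6 * u / D + of_int (beta1 u) * (6 * u * (1 + u) / D + 6 * u / D)) / (6 * u / D)"
    using assms D by (simp add: field_simps)
  also have "\<dots> \<le> of_int (alpha1 u)"
    unfolding alpha1_def Let_def e by (rule le_of_int_ceiling)
  finally show ?thesis .
qed

lemma not_takens_linearization_metallic_mean:
  assumes "a \<ge> 1"
  shows "\<not> takens_linearization_possible (metallic_mean a)"
proof -
  let ?x = "metallic_mean a"
  have "real a + 2 \<le> of_int (alpha1 ?x)"
    using alpha1_ge[OF metallic_mean_pos[of a]] metallic_mean_greater[of a] by linarith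
  then have "\<bar>int a\<bar> + \<bar>-1\<bar> + \<bar>1\<bar> \<le> alpha1 ?x"
    by linarith
  moreover have "of_int (int a) * eigval1 ?x + of_int (-1) * eigval2 ?x + of_int 1 * eigval3 ?x
      = 6 * (?x\<^sup>2 - real a * ?x - 1) / (1 + ?x + ?x\<^sup>2)"
    unfolding eigval1_def eigval2_def eigval3_def
    by (simp add: diff_divide_distrib add_divide_distrib power2_eq_square algebra_simps)
  then have "of_int (int a) * eigval1 ?x + of_int (-1) * eigval2 ?x + of_int 1 * eigval3 ?x = 0"
    by (simp add: metallic_mean_square)
  \<comment> \<open>The signs are +, -, + since \<open>a \<ge> 1\<close>, and the odd one out is the
    middle entry -1.\<close>
  moreover have "RSC (int a) (-1) 1"
    using assms by (simp add: RSC_def)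
  moreover have "(int a, -1, 1) \<noteq> (0, 0, 0 :: int)"
    by simp
  ultimately show ?thesis
    unfolding takens_linearization_possible_def SNC_def by blast
qed

text \<open>The leading entry counts down while the tail is kept. At \<open>m = 1\<close> the
  parameter lies below 2, and inverting its fractional part \<open>1 / metallic_mean a\<close>
  restores the whole expansion, with leading entry \<open>a\<close>.\<close>

lemma kasner_map_metallic:
  assumes "a \<ge> 1" "m \<ge> 1"
  shows "kasner_map (real m + 1 / metallic_mean a)
    = real (if m = 1 then a else m - 1) + 1 / metallic_mean a"
proof -
  have x: "metallic_mean a > 1"
    using metallic_mean_greater[of a] assms by linarith
  show ?thesis
  proof (cases "m = 1")
    case True
    then show ?thesis
      using x metallic_mean_fixpoint[of a] by (simp add: kasner_map_def)
  next
    case False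
    then have "real m \<ge> 2"
      using assms by linarith
    moreover have "1 / metallic_mean a > 0"
      using x by simp
    ultimately have "real m + 1 / metallic_mean a \<ge> 2"
      by linarith
    then show ?thesis
      using False assms by (simp add: kasner_map_def of_nat_diff)
  qed
qed

text \<open>The orbit is the cycle of leading entries a, a-1, ..., 1: the set on the right contains
  the start and is closed under the map, and entry \<open>m\<close> is reached after
  \<open>a - m\<close> steps.\<close>

lemma base_points_metallic_mean:
  assumes "a \<ge> 1"
  shows "base_points (metallic_mean a) = (\<lambda>m. real m + 1 / metallic_mean a) ` {1..a}"
    (is "_ = ?u ` _")
proof (intro equalityI subsetI)
  fix y assume "y \<in> base_points (metallic_mean a)"
  then obtain j where y: "y = (kasner_map ^^ j) (metallic_mean a)"
    unfolding base_points_def by blast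
  have "(kasner_map ^^ j) (metallic_mean a) \<in> ?u ` {1..a}"
  proof (induction j)
    case 0
    have "metallic_mean a = ?u a"
      by (rule metallic_mean_fixpoint)
    then show ?case
      using assms by auto
  next
    case (Suc j)
    then obtain m where m: "m \<in> {1..a}" "(kasner_map ^^ j) (metallic_mean a) = ?u m"
      by blast
    then have "(kasner_map ^^ Suc j) (metallic_mean a) = ?u (if m = 1 then a else m - 1)"
      using kasner_map_metallic[OF assms] by simp
    moreover have "(if m = 1 then a else m - 1) \<in> {1..a}"
      using m(1) by auto
    ultimately show ?case
      by blast
  qed
  then show "y \<in> ?u ` {1..a}"
    unfolding y .
next
  fix y assume "y \<in> ?u ` {1..a}"
  then obtain m where m: "m \<in> {1..a}" "y = ?u m"
    by blast
  \<comment> \<open>The bound \<open>j < a\<close> stops the countdown before it wraps from 1 back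
    to \<open>a\<close>.\<close>
  have "(kasner_map ^^ j) (metallic_mean a) = ?u (a - j)" if "j < a" for j
    using that
  proof (induction j)
    case 0
    then show ?case
      using metallic_mean_fixpoint by simp
  next
    case (Suc j)
    then show ?case
      using kasner_map_metallic[OF assms, of "a - j"] by simp
  qed
  from this[of "a - m"] have "y = (kasner_map ^^ (a - m)) (metallic_mean a)"
    using m by simp
  then show "y \<in> base_points (metallic_mean a)"
    unfolding base_points_def by blast
qed

theorem theorem0p2:
  fixes a :: nat and u :: "nat \<Rightarrow> real"
  assumes "a \<ge> 1"
    and "\<And>m. u m = cf_value (\<lambda>i. if i = 0 then m else a)"
  shows "base_points (cf_value (\<lambda>_. a)) = u ` {1..a} \<and>
         (\<exists>m\<in>{1..a}. \<not> takens_linearization_possible (u m))"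
proof
  have u: "u = (\<lambda>m. real m + 1 / metallic_mean a)"
    using assms(2) cf_value_Cons_const[OF assms(1)] by auto
  show "base_points (cf_value (\<lambda>_. a)) = u ` {1..a}"
    unfolding u cf_value_const[OF assms(1)] by (rule base_points_metallic_mean[OF assms(1)])
  have "u a = metallic_mean a"
    unfolding u using metallic_mean_fixpoint[of a] by simp
  then show "\<exists>m\<in>{1..a}. \<not> takens_linearization_possible (u m)"
    using not_takens_linearization_metallic_mean[OF assms(1)] assms(1) by force
qed

end
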